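(* Let $\mathcal{H}$ be a separable complex Hilbert space and let $T$ be a bounded linear operator on $\mathcal{H}$. If $T$ is a pure finite-isometry, then $T$ is unitarily equivalent to an analytic shift; that is, there exist a reproducing kernel Hilbert space $\mathcal{H}_k$ of vector-valued analytic functions on the open unit disc, on which multiplication by $z$, $M_z$, is an analytic shift, and a unitary $U:\mathcal{H}\to\mathcal{H}_k$ such that $UT=M_zU$.
   Context: An operator $T\in\mathcal{B}(\mathcal{H})$ is hyponormal if $TT^*\le T^*T$. It is a contraction if $\|Th\|\le\|h\|$ for all $h\in\mathcal{H}$. A hyponormal operator is pure if there is no nonzero closed reducing subspace on which its restriction is a normal operator. $T$ is a finite-isometry if $T$ is a hyponormal contraction and $\operatorname{rank}(I-T^*T)<\infty$. Let $\mathbb{D}$ be the open unit disc in $\mathbb{C}$. A reproducing kernel Hilbert space $\mathcal{H}_k$ here means a Hilbert space of $\mathcal{E}$-valued analytic functions on $\mathbb{D}$ (for some Hilbert space $\mathcal{E}$) such that for every $w\in\mathbb{D}$ the evaluation map $ev_w:\mathcal{H}_k\to\mathcal{E}$, $ev_w(f)=f(w)$, is continuous; its kernel is $k(z,w)=ev_z\circ ev_w^*$. The multiplication operator $M_z$ is defined by $(M_zf)(z)=zf(z)$. $M_z$ on $\mathcal{H}_k$ is called an analytic shift if it is a (well-defined) contraction on $\mathcal{H}_k$ and is left-invertible. *)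

theory Defs
  imports "HOL-Analysis.Analysis" "HOL-Library.Function_Algebras"
begin

section \<open>Complex vector spaces and complex Hilbert spaces\<close>

class complex_vector = ab_group_add +
  fixes scaleC :: "complex \<Rightarrow> 'a \<Rightarrow> 'a" (infixr "*\<^sub>C" 75)
  assumes scaleC_add_right: "a *\<^sub>C (x + y) = a *\<^sub>C x + a *\<^sub>C y"
    and scaleC_add_left: "(a + b) *\<^sub>C x = a *\<^sub>C x + b *\<^sub>C x"
    and scaleC_scaleC: "a *\<^sub>C (b *\<^sub>C x) = (a * b) *\<^sub>C x"
    and scaleC_one: "1 *\<^sub>C x = x"

abbreviation csubspace :: "'a::complex_vector set \<Rightarrow> bool"
  where "csubspace \<equiv> module.subspace scaleC"

abbreviation cspan :: "'a::complex_vector set \<Rightarrow> 'a set"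
  where "cspan \<equiv> module.span scaleC"

instantiation "fun" :: (type, complex_vector) complex_vector
begin

definition scaleC_fun :: "complex \<Rightarrow> ('a \<Rightarrow> 'b) \<Rightarrow> 'a \<Rightarrow> 'b"
  where "scaleC_fun c f = (\<lambda>x. c *\<^sub>C f x)"

instance
  by standard
    (auto simp: scaleC_fun_def fun_eq_iff scaleC_add_right scaleC_add_left scaleC_scaleC scaleC_one)

end

text \<open>The inner product is linear in the first argument and conjugate-linear in the second.
  Completeness of the norm is inherited from class \<^class>\<open>banach\<close>; the axiom
  \<open>cinner_self\<close> makes the form positive definite with \<open>norm\<close> as its norm.\<close>

class complex_hilbert_space = complex_vector + banach +
  fixes cinner :: "'a \<Rightarrow> 'a \<Rightarrow> complex"
  assumes scaleR_scaleC: "r *\<^sub>R x = complex_of_real r *\<^sub>C x"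
    and cinner_commute: "cinner x y = cnj (cinner y x)"
    and cinner_add_left: "cinner (x + y) z = cinner x z + cinner y z"
    and cinner_scaleC_left: "cinner (c *\<^sub>C x) y = c * cinner x y"
    and cinner_self: "cinner x x = complex_of_real ((norm x)\<^sup>2)"


section \<open>Operators on a Hilbert space\<close>

definition bounded_clinear :: "('a::complex_hilbert_space \<Rightarrow> 'a) \<Rightarrow> bool"
  where "bounded_clinear T \<longleftrightarrow> bounded_linear T \<and> (\<forall>c x. T (c *\<^sub>C x) = c *\<^sub>C T x)"

text \<open>The adjoint of the restriction of \<open>T\<close> to \<open>M\<close>, as an operator on the Hilbert space \<open>M\<close>.
  It is meaningful for bounded \<open>T\<close> and closed \<open>T\<close>-invariant subspaces \<open>M\<close> (Riesz), at points
  of \<open>M\<close>.\<close>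

definition cadjoint_on ::
    "'a::complex_hilbert_space set \<Rightarrow> ('a \<Rightarrow> 'a) \<Rightarrow> 'a \<Rightarrow> 'a"
  where "cadjoint_on M T y = (THE z. z \<in> M \<and> (\<forall>x\<in>M. cinner (T x) y = cinner x z))"

abbreviation cadjoint :: "('a::complex_hilbert_space \<Rightarrow> 'a) \<Rightarrow> 'a \<Rightarrow> 'a"
  where "cadjoint \<equiv> cadjoint_on UNIV"

definition op_le :: "('a::complex_hilbert_space \<Rightarrow> 'a) \<Rightarrow> ('a \<Rightarrow> 'a) \<Rightarrow> bool"
  where "op_le A B \<longleftrightarrow> (\<forall>h. cinner (B h - A h) h \<in> \<real>\<^sub>\<ge>\<^sub>0)"

definition hyponormal :: "('a::complex_hilbert_space \<Rightarrow> 'a) \<Rightarrow> bool"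
  where "hyponormal T \<longleftrightarrow> op_le (T \<circ> cadjoint T) (cadjoint T \<circ> T)"

definition contraction :: "('a::complex_hilbert_space \<Rightarrow> 'a) \<Rightarrow> bool"
  where "contraction T \<longleftrightarrow> (\<forall>h. norm (T h) \<le> norm h)"

definition finite_rank :: "('a::complex_hilbert_space \<Rightarrow> 'a) \<Rightarrow> bool"
  where "finite_rank A \<longleftrightarrow> (\<exists>B. finite B \<and> range A \<subseteq> cspan B)"

definition finite_isometry :: "('a::complex_hilbert_space \<Rightarrow> 'a) \<Rightarrow> bool"
  where "finite_isometry T \<longleftrightarrow>
    hyponormal T \<and> contraction T \<and> finite_rank (\<lambda>h. h - cadjoint T (T h))"

definition ortho_compl :: "'a::complex_hilbert_space set \<Rightarrow> 'a set"
  where "ortho_compl M = {x. \<forall>m\<in>M. cinner x m = 0}"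

definition reducing :: "('a::complex_hilbert_space \<Rightarrow> 'a) \<Rightarrow> 'a set \<Rightarrow> bool"
  where "reducing T M \<longleftrightarrow> csubspace M \<and> T ` M \<subseteq> M \<and> T ` ortho_compl M \<subseteq> ortho_compl M"

definition normal_on :: "'a::complex_hilbert_space set \<Rightarrow> ('a \<Rightarrow> 'a) \<Rightarrow> bool"
  where "normal_on M T \<longleftrightarrow> (\<forall>x\<in>M. cadjoint_on M T (T x) = T (cadjoint_on M T x))"

definition pure_hyponormal :: "('a::complex_hilbert_space \<Rightarrow> 'a) \<Rightarrow> bool"
  where "pure_hyponormal T \<longleftrightarrow> hyponormal T \<and>
    \<not> (\<exists>M. closed M \<and> reducing T M \<and> M \<noteq> {0} \<and> normal_on M T)"


section \<open>Hilbert spaces carried by a subspace of a complex vector space\<close>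

definition ip_norm :: "('v \<Rightarrow> 'v \<Rightarrow> complex) \<Rightarrow> 'v \<Rightarrow> real"
  where "ip_norm ip f = sqrt (Re (ip f f))"

definition inner_product_on :: "'v::complex_vector set \<Rightarrow> ('v \<Rightarrow> 'v \<Rightarrow> complex) \<Rightarrow> bool"
  where "inner_product_on V ip \<longleftrightarrow>
    (\<forall>f\<in>V. \<forall>g\<in>V. ip f g = cnj (ip g f)) \<and>
    (\<forall>f\<in>V. \<forall>g\<in>V. \<forall>h\<in>V. ip (f + g) h = ip f h + ip g h) \<and>
    (\<forall>c. \<forall>f\<in>V. \<forall>g\<in>V. ip (c *\<^sub>C f) g = c * ip f g) \<and>
    (\<forall>f\<in>V. f \<noteq> 0 \<longrightarrow> 0 < Re (ip f f))"

definition complete_on :: "'v::complex_vector set \<Rightarrow> ('v \<Rightarrow> 'v \<Rightarrow> complex) \<Rightarrow> bool"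
  where "complete_on V ip \<longleftrightarrow>
    (\<forall>s. (\<forall>n::nat. s n \<in> V) \<and>
         (\<forall>e>0. \<exists>N. \<forall>m\<ge>N. \<forall>n\<ge>N. ip_norm ip (s m - s n) < e)
       \<longrightarrow> (\<exists>f\<in>V. (\<lambda>n. ip_norm ip (s n - f)) \<longlonglongrightarrow> 0))"

definition hilbert_space_on :: "'v::complex_vector set \<Rightarrow> ('v \<Rightarrow> 'v \<Rightarrow> complex) \<Rightarrow> bool"
  where "hilbert_space_on V ip \<longleftrightarrow> csubspace V \<and> inner_product_on V ip \<and> complete_on V ip"

definition bounded_op_on ::
    "'v::complex_vector set \<Rightarrow> ('v \<Rightarrow> 'v \<Rightarrow> complex) \<Rightarrow> ('v \<Rightarrow> 'v) \<Rightarrow> bool"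
  where "bounded_op_on V ip S \<longleftrightarrow>
    S ` V \<subseteq> V \<and>
    (\<forall>f\<in>V. \<forall>g\<in>V. S (f + g) = S f + S g) \<and>
    (\<forall>c. \<forall>f\<in>V. S (c *\<^sub>C f) = c *\<^sub>C S f) \<and>
    (\<exists>K. \<forall>f\<in>V. ip_norm ip (S f) \<le> K * ip_norm ip f)"

definition unitary_onto ::
    "('a::complex_hilbert_space \<Rightarrow> 'v::complex_vector) \<Rightarrow> 'v set \<Rightarrow> ('v \<Rightarrow> 'v \<Rightarrow> complex) \<Rightarrow> bool"
  where "unitary_onto U V ip \<longleftrightarrow>
    (\<forall>x y. U (x + y) = U x + U y) \<and> (\<forall>c x. U (c *\<^sub>C x) = c *\<^sub>C U x) \<and>
    (\<forall>x y. ip (U x) (U y) = cinner x y) \<and> range U = V"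


section \<open>Reproducing kernel Hilbert spaces of analytic functions on the unit disc\<close>

abbreviation unit_disc :: "complex set"
  where "unit_disc \<equiv> ball 0 1"

definition analytic_on_disc :: "(complex \<Rightarrow> 'a::complex_hilbert_space) \<Rightarrow> bool"
  where "analytic_on_disc f \<longleftrightarrow>
    (\<forall>w\<in>unit_disc. \<exists>d. ((\<lambda>z. (1 / (z - w)) *\<^sub>C (f z - f w)) \<longlongrightarrow> d) (at w))"

text \<open>\<open>rkhs E F ip\<close>: \<open>F\<close> with inner product \<open>ip\<close> is a reproducing kernel Hilbert space of
  analytic functions from the disc to the Hilbert space \<open>E\<close>, a closed subspace of the ambient
  Hilbert space type.  Functions on the disc are represented by their extension by zero, so that
  equality in \<open>F\<close> is equality on the disc.  The last clause is continuity of each evaluation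
  map.\<close>

definition rkhs ::
    "'a::complex_hilbert_space set \<Rightarrow> (complex \<Rightarrow> 'a) set \<Rightarrow>
      ((complex \<Rightarrow> 'a) \<Rightarrow> (complex \<Rightarrow> 'a) \<Rightarrow> complex) \<Rightarrow> bool"
  where "rkhs E F ip \<longleftrightarrow>
    csubspace E \<and> closed E \<and> hilbert_space_on F ip \<and>
    (\<forall>f\<in>F. f ` unit_disc \<subseteq> E \<and> (\<forall>z. z \<notin> unit_disc \<longrightarrow> f z = 0) \<and> analytic_on_disc f) \<and>
    (\<forall>w\<in>unit_disc. \<forall>f\<in>F. \<forall>e>0. \<exists>d>0. \<forall>g\<in>F.
        ip_norm ip (g - f) < d \<longrightarrow> norm (g w - f w) < e)"

definition mult_z :: "(complex \<Rightarrow> 'a::complex_vector) \<Rightarrow> complex \<Rightarrow> 'a"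
  where "mult_z f = (\<lambda>z. z *\<^sub>C f z)"

definition mult_z_analytic_shift ::
    "(complex \<Rightarrow> 'a::complex_vector) set \<Rightarrow>
      ((complex \<Rightarrow> 'a) \<Rightarrow> (complex \<Rightarrow> 'a) \<Rightarrow> complex) \<Rightarrow> bool"
  where "mult_z_analytic_shift F ip \<longleftrightarrow>
    mult_z ` F \<subseteq> F \<and>
    (\<forall>f\<in>F. ip_norm ip (mult_z f) \<le> ip_norm ip f) \<and>
    (\<exists>L. bounded_op_on F ip L \<and> (\<forall>f\<in>F. L (mult_z f) = f))"

end

theory Submission
  imports Defs "HOL-Computational_Algebra.Fundamental_Theorem_Algebra"
begin

text \<open>Let \<open>N = ker (I - T*T)\<close>, a subspace of finite codimension on which \<open>T\<close> is isometric.
  Hyponormality makes \<open>N\<close> invariant under \<open>T\<close>, so \<open>T\<close> acts on the finite-dimensional quotient by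
  \<open>N\<close> and some polynomial \<open>p \<noteq> 0\<close> satisfies \<open>p(T) H \<subseteq> N\<close>.  An eigenspace of a hyponormal
  operator is reducing, so purity excludes eigenvectors and \<open>p(T)\<close> is injective.  The isometry on
  \<open>N\<close> has no unitary part, because that part would reduce \<open>T\<close>; hence
  \<open>x \<mapsto> \<Sum>n. z^n (I - TT*) T*^n x\<close> is injective on \<open>N\<close>, and it intertwines \<open>T\<close> with multiplication
  by \<open>z\<close>.  The model map is this map composed with \<open>p(T)\<close>, its range carrying the inner product
  of \<open>H\<close>.  The Cauchy-dual model \<open>\<Sum>n. z^n P L^n\<close> with \<open>L = (T*T)^{-1} T*\<close> would not do, since its
  series may diverge inside the disc.  A left inverse of \<open>T\<close> exists because the injective operator
  \<open>T*T\<close> is a finite-rank perturbation of the identity, hence algebraic and invertible.\<close>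

section \<open>Complex Hilbert spaces\<close>

interpretation complex_vector: vector_space "scaleC :: complex \<Rightarrow> 'a::complex_vector \<Rightarrow> 'a"
  by standard (auto simp: scaleC_add_right scaleC_add_left scaleC_scaleC scaleC_one)

lemma cinner_add_right: "cinner x (y + z) = cinner x y + cinner x z"
  by (metis cinner_add_left cinner_commute complex_cnj_add)

lemma cinner_scaleC_right: "cinner x (c *\<^sub>C y) = cnj c * cinner x y"
  by (metis cinner_scaleC_left cinner_commute complex_cnj_mult)

lemma cinner_diff_left: "cinner (x - y) z = cinner x z - cinner y z"
  by (metis add_diff_cancel_right' cinner_add_left diff_add_cancel)

lemma cinner_diff_right: "cinner x (y - z) = cinner x y - cinner x z"
  by (metis add_diff_cancel_right' cinner_add_right diff_add_cancel)

lemma cinner_zero_left [simp]: "cinner 0 x = 0"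
  using cinner_diff_left[of 0 0 x] by simp

lemma cinner_zero_right [simp]: "cinner x 0 = 0"
  using cinner_diff_right[of x 0 0] by simp

lemma cinner_right_cancel:
  assumes "\<And>x. cinner x y = cinner x z"
  shows "y = z"
proof -
  have "cinner (y - z) (y - z) = 0"
    by (simp add: cinner_diff_right assms)
  then show ?thesis
    by (simp add: cinner_self)
qed

lemma norm_scaleC [simp]: "norm (c *\<^sub>C x) = cmod c * norm (x::'a::complex_hilbert_space)"
proof -
  have "complex_of_real ((norm (c *\<^sub>C x))\<^sup>2) = c * (cnj c * complex_of_real ((norm x)\<^sup>2))"
    by (metis cinner_scaleC_left cinner_scaleC_right cinner_self)
  also have "\<dots> = complex_of_real ((cmod c * norm x)\<^sup>2)"
    by (simp add: power_mult_distrib complex_norm_square mult.assoc del: of_real_power)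
  finally have "(norm (c *\<^sub>C x))\<^sup>2 = (cmod c * norm x)\<^sup>2"
    by (simp only: of_real_eq_iff)
  then show ?thesis
    by (simp add: power2_eq_iff_nonneg)
qed

lemma norm_add_squared:
  "(norm (x + y))\<^sup>2 = (norm x)\<^sup>2 + 2 * Re (cinner x y) + (norm y)\<^sup>2"
proof -
  have "Re (cinner (x + y) (x + y)) = Re (cinner x x) + 2 * Re (cinner x y) + Re (cinner y y)"
    using cinner_commute[of y x] by (simp add: cinner_add_left cinner_add_right)
  then show ?thesis
    by (simp add: cinner_self)
qed

lemma norm_diff_squared:
  "(norm (x - y))\<^sup>2 = (norm x)\<^sup>2 - 2 * Re (cinner x y) + (norm y)\<^sup>2"
  using norm_add_squared[of "x - y" y] by (simp add: cinner_diff_left cinner_self power2_eq_square)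

text \<open>The triangle inequality comes with the class \<open>banach\<close>, so Cauchy-Schwarz is
  read off from it by expanding squares, the reverse of the usual order.\<close>

lemma Re_cinner_le: "Re (cinner x y) \<le> norm x * norm y"
proof -
  have "(norm (x + y))\<^sup>2 \<le> (norm x + norm y)\<^sup>2"
    by (intro power_mono norm_triangle_ineq) auto
  then show ?thesis
    unfolding norm_add_squared by (simp add: power2_sum)
qed

lemma bounded_bilinear_scaleC:
  "bounded_bilinear (scaleC :: complex \<Rightarrow> 'a::complex_hilbert_space \<Rightarrow> 'a)"
proof
  show "\<exists>K. \<forall>a (b::'a). norm (a *\<^sub>C b) \<le> norm a * norm b * K"
    by (rule exI[of _ 1]) simp
qed (auto simp: scaleC_add_left scaleC_add_right scaleR_scaleC scaleC_scaleC scaleR_conv_of_real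
       mult.commute)

lemmas bounded_linear_scaleC_right = bounded_bilinear.bounded_linear_right[OF bounded_bilinear_scaleC]

text \<open>The representing vector minimises \<open>J x = (norm x)^2 - 2 * \<phi> x\<close>:
  minimising sequences are Cauchy by the parallelogram law, and the identity expresses that the
  minimum is stationary in every direction.\<close>

lemma riesz_representation:
  fixes \<phi> :: "'a::complex_hilbert_space \<Rightarrow> real"
  assumes "bounded_linear \<phi>"
  obtains z where "\<And>x. \<phi> x = Re (cinner x z)"
proof -
  interpret \<phi>: bounded_linear \<phi> by fact
  obtain K where K: "\<And>x. norm (\<phi> x) \<le> norm x * K"
    using \<phi>.bounded by blast
  define J where "J x = (norm x)\<^sup>2 - 2 * \<phi> x" for x
  have "- K\<^sup>2 \<le> J x" for x
  proof -
    have "0 \<le> (norm x - K)\<^sup>2" by simp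
    with K[of x] show ?thesis
      by (simp add: J_def power2_diff)
  qed
  then have bdd: "bdd_below (range J)" by (rule bdd_belowI2)
  define m where "m = Inf (range J)"
  have m_le: "m \<le> J x" for x
    unfolding m_def using bdd by (intro cInf_lower) auto
  have "\<exists>x. J x < m + 1 / Suc n" for n :: nat
    using cInf_lessD[of "range J" "m + 1 / Suc n"] unfolding m_def by auto
  then obtain s where s: "\<And>n::nat. J (s n) < m + 1 / Suc n" by metis
  \<comment> \<open>Parallelogram law; the contributions of \<open>\<phi>\<close> cancel because it
    is linear.\<close>
  have par: "(norm (x - y))\<^sup>2 = 2 * J x + 2 * J y - 4 * J ((1/2) *\<^sub>R (x + y))" for x y
  proof -
    have "(norm ((1/2) *\<^sub>R (x + y)))\<^sup>2 = (norm (x + y))\<^sup>2 / 4"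
      by (simp add: power_divide)
    then show ?thesis
      unfolding J_def norm_diff_squared by (simp add: \<phi>.scaleR \<phi>.add norm_add_squared field_simps)
  qed
  have close: "(norm (s i - s j))\<^sup>2 < 2 * (1 / Suc i) + 2 * (1 / Suc j)" for i j
    using par[of "s i" "s j"] s[of i] s[of j] m_le[of "(1/2) *\<^sub>R (s i + s j)"]
    by linarith
  have "Cauchy s"
  proof (rule metric_CauchyI)
    fix e :: real assume "0 < e"
    then obtain N :: nat where N: "4 / e\<^sup>2 < N"
      using reals_Archimedean2 by blast
    have "dist (s i) (s j) < e" if "N \<le> i" "N \<le> j" for i j
    proof -
      have "4 < e\<^sup>2 * N"
        using N \<open>0 < e\<close> by (simp add: field_simps)
      also have "\<dots> \<le> e\<^sup>2 * Suc N" by (simp add: mult_left_mono)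
      finally have "4 * (1 / Suc N) < e\<^sup>2" by (simp add: field_simps)
      moreover have "1 / Suc i \<le> 1 / Suc N" "1 / Suc j \<le> 1 / Suc N"
        using that by (auto intro!: divide_left_mono)
      ultimately have "(norm (s i - s j))\<^sup>2 < e\<^sup>2"
        using close[of i j] by linarith
      then show ?thesis
        using \<open>0 < e\<close> by (simp add: dist_norm power2_less_imp_less)
    qed
    then show "\<exists>N. \<forall>i\<ge>N. \<forall>j\<ge>N. dist (s i) (s j) < e" by blast
  qed
  then obtain z where z: "s \<longlonglongrightarrow> z"
    using Cauchy_convergent convergent_def by blast
  have "(\<lambda>n. J (s n)) \<longlonglongrightarrow> J z"
    unfolding J_def by (intro tendsto_intros z \<phi>.tendsto)
  moreover have "(\<lambda>n. m + 1 / Suc n) \<longlonglongrightarrow> m + 0"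
    by (intro tendsto_intros LIMSEQ_inverse_real_of_nat[unfolded inverse_eq_divide])
  ultimately have "J z \<le> m"
    using LIMSEQ_le[of "\<lambda>n. J (s n)" "J z" "\<lambda>n. m + 1 / Suc n" m] s
    by (auto intro: less_imp_le)
  then have min: "J z \<le> J x" for x
    using m_le[of x] by simp
  have "\<phi> h = Re (cinner h z)" for h
  proof (cases "h = 0")
    case False
    define c where "c = Re (cinner h z) - \<phi> h"
    \<comment> \<open>This \<open>t\<close> minimises the quadratic
      \<open>J (z + t h) = J z + 2 t c + t^2 (norm h)^2\<close>.\<close>
    define t where "t = - c / (norm h)\<^sup>2"
    have "\<phi> (complex_of_real t *\<^sub>C h) = t * \<phi> h"
      using \<phi>.scaleR[of t h] by (simp add: scaleR_scaleC)
    moreover have "Re (cinner z h) = Re (cinner h z)"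
      by (subst cinner_commute) simp
    ultimately have "J (z + t *\<^sub>R h) = J z + 2 * t * c + t\<^sup>2 * (norm h)\<^sup>2"
      unfolding J_def c_def
      by (simp add: norm_add_squared \<phi>.add scaleR_scaleC cinner_scaleC_right
          power_mult_distrib algebra_simps)
    also have "\<dots> = J z - c\<^sup>2 / (norm h)\<^sup>2"
      using False by (simp add: t_def power2_eq_square field_simps)
    finally have "c\<^sup>2 / (norm h)\<^sup>2 \<le> 0"
      using min[of "z + t *\<^sub>R h"] by simp
    with False have "c = 0"
      by (simp add: divide_le_0_iff)
    then show ?thesis by (simp add: c_def)
  qed (simp add: \<phi>.zero)
  then show ?thesis by (rule that)
qed


section \<open>Bounded operators and adjoints\<close>

lemma bounded_clinear_add: "bounded_clinear f \<Longrightarrow> f (x + y) = f x + f y"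
  by (simp add: bounded_clinear_def linear_add bounded_linear.linear)

lemma bounded_clinear_diff: "bounded_clinear f \<Longrightarrow> f (x - y) = f x - f y"
  by (simp add: bounded_clinear_def linear_diff bounded_linear.linear)

lemma bounded_clinear_minus: "bounded_clinear f \<Longrightarrow> f (- x) = - f x"
  by (simp add: bounded_clinear_def linear_neg bounded_linear.linear)

lemma bounded_clinear_scaleC: "bounded_clinear f \<Longrightarrow> f (c *\<^sub>C x) = c *\<^sub>C f x"
  by (simp add: bounded_clinear_def)

lemma bounded_clinear_zero: "bounded_clinear f \<Longrightarrow> f 0 = 0"
  by (simp add: bounded_clinear_def linear_0 bounded_linear.linear)

lemma bounded_clinear_sum: "bounded_clinear f \<Longrightarrow> f (sum g A) = (\<Sum>i\<in>A. f (g i))"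
  by (simp add: bounded_clinear_def linear_sum bounded_linear.linear)

lemmas bounded_clinear_simps = bounded_clinear_add bounded_clinear_diff bounded_clinear_scaleC
  bounded_clinear_zero

lemma bounded_clinear_bound:
  assumes "bounded_clinear f"
  obtains K where "0 \<le> K" "\<And>x. norm (f x) \<le> K * norm x"
  using assms bounded_linear.nonneg_bounded[of f] by (auto simp: bounded_clinear_def mult.commute)

lemma bounded_clinear_continuous_on: "bounded_clinear f \<Longrightarrow> continuous_on S f"
  by (simp add: bounded_clinear_def linear_continuous_on)

lemma bounded_clinearI:
  assumes "\<And>x y. f (x + y) = f x + f y" "\<And>c x. f (c *\<^sub>C x) = c *\<^sub>C f x"
    and "\<And>x. norm (f x) \<le> K * norm x"
  shows "bounded_clinear f"
  unfolding bounded_clinear_def using assms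
  by (auto intro!: bounded_linear_intro[where K = K] simp: scaleR_scaleC mult.commute)

lemma linear_bounded_clinear: "bounded_clinear f \<Longrightarrow> Vector_Spaces.linear scaleC scaleC f"
  by (simp add: Vector_Spaces.linear_iff complex_vector.vector_space_axioms bounded_clinear_simps)

lemma bounded_clinear_id: "bounded_clinear (\<lambda>x. x)"
  by (simp add: bounded_clinear_def bounded_linear_ident)

lemma bounded_clinear_zero_map: "bounded_clinear (\<lambda>x. 0)"
  by (simp add: bounded_clinear_def bounded_linear_zero)

lemma bounded_clinear_scale_map: "bounded_clinear (scaleC c)"
  by (simp add: bounded_clinear_def bounded_linear_scaleC_right mult.commute)

lemma bounded_clinear_compose:
  "bounded_clinear f \<Longrightarrow> bounded_clinear g \<Longrightarrow> bounded_clinear (\<lambda>x. f (g x))"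
  by (simp add: bounded_clinear_def bounded_linear_compose)

lemma bounded_clinear_add_map:
  "bounded_clinear f \<Longrightarrow> bounded_clinear g \<Longrightarrow> bounded_clinear (\<lambda>x. f x + g x)"
  by (simp add: bounded_clinear_def bounded_linear_add scaleC_add_right)

lemma bounded_clinear_diff_map:
  "bounded_clinear f \<Longrightarrow> bounded_clinear g \<Longrightarrow> bounded_clinear (\<lambda>x. f x - g x)"
  by (simp add: bounded_clinear_def bounded_linear_sub complex_vector.scale_right_diff_distrib)

lemma bounded_clinear_funpow: "bounded_clinear f \<Longrightarrow> bounded_clinear (f ^^ n)"
proof (induction n)
  case 0
  then show ?case using bounded_clinear_id by (simp add: id_def)
next
  case (Suc n)
  then show ?case using bounded_clinear_compose[of f "f ^^ n"] by (simp add: o_def)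
qed

section \<open>Uniqueness, existence and boundedness of adjoints\<close>

lemma cadjoint_on_eqI:
  assumes "csubspace M" "z \<in> M" "\<And>x. x \<in> M \<Longrightarrow> cinner (T x) y = cinner x z"
  shows "cadjoint_on M T y = z"
  unfolding cadjoint_on_def
proof (rule the_equality)
  fix w assume w: "w \<in> M \<and> (\<forall>x\<in>M. cinner (T x) y = cinner x w)"
  then have "w - z \<in> M"
    using assms by (simp add: complex_vector.subspace_diff)
  then have "cinner (w - z) w = cinner (w - z) z"
    using w assms(3) by metis
  then have "cinner (w - z) (w - z) = 0"
    by (simp add: cinner_diff_right)
  then show "w = z"
    by (simp add: cinner_self)
qed (use assms in auto)

text \<open>Riesz represents the real part of \<open>cinner (T x) y\<close>; evaluating at
  \<open>\<i> *\<^sub>C x\<close> recovers the imaginary part.\<close>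

lemma cinner_cadjoint:
  assumes T: "bounded_clinear T"
  shows "cinner (T x) y = cinner x (cadjoint T y)"
proof -
  obtain K where K: "0 \<le> K" "\<And>x. norm (T x) \<le> K * norm x"
    using T bounded_clinear_bound by blast
  have le: "\<bar>Re (cinner (T x) y)\<bar> \<le> norm x * (K * norm y)" for x
  proof -
    have "Re (cinner (T x) y) \<le> norm (T x) * norm y" for x
      by (rule Re_cinner_le)
    also have "\<dots> x \<le> norm x * (K * norm y)" for x
      using mult_right_mono[OF K(2)[of x] norm_ge_zero[of y]] by (simp add: mult_ac)
    finally have *: "Re (cinner (T x) y) \<le> norm x * (K * norm y)" for x .
    have "- Re (cinner (T x) y) = Re (cinner (T (- x)) y)"
      using bounded_clinear_diff[OF T, of 0 x] cinner_diff_left[of 0 "T x" y]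
      by (simp add: bounded_clinear_zero[OF T])
    also have "\<dots> \<le> norm x * (K * norm y)"
      using *[of "- x"] by simp
    finally show ?thesis using *[of x] by simp
  qed
  have "bounded_linear (\<lambda>x. Re (cinner (T x) y))"
    using le by (intro bounded_linear_intro[where K = "K * norm y"])
      (auto simp: bounded_clinear_simps[OF T] cinner_add_left scaleR_scaleC cinner_scaleC_left)
  then obtain z where z: "\<And>x. Re (cinner (T x) y) = Re (cinner x z)"
    using riesz_representation by blast
  have "Im (cinner (T x) y) = Im (cinner x z)" for x
    using z[of "\<i> *\<^sub>C x"] by (simp add: bounded_clinear_simps[OF T] cinner_scaleC_left)
  with z have eq: "cinner (T x) y = cinner x z" for x
    by (simp add: complex_eq_iff)
  then have "cadjoint T y = z"
    by (intro cadjoint_on_eqI) auto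
  with eq show ?thesis by simp
qed

lemma cinner_cadjoint_left:
  assumes "bounded_clinear T"
  shows "cinner (cadjoint T x) y = cinner x (T y)"
  by (metis assms cinner_cadjoint cinner_commute)

lemma bounded_clinear_cadjoint:
  assumes T: "bounded_clinear T"
  shows "bounded_clinear (cadjoint T)"
proof -
  obtain K where K: "0 \<le> K" "\<And>x. norm (T x) \<le> K * norm x"
    using T bounded_clinear_bound by blast
  show ?thesis
  proof (rule bounded_clinearI[where K = K])
    fix x y
    show "cadjoint T (x + y) = cadjoint T x + cadjoint T y"
      by (rule cinner_right_cancel)
        (simp add: cinner_add_right flip: cinner_cadjoint[OF T])
  next
    fix c x
    show "cadjoint T (c *\<^sub>C x) = c *\<^sub>C cadjoint T x"
      by (rule cinner_right_cancel)
        (simp add: cinner_scaleC_right flip: cinner_cadjoint[OF T])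
  next
    fix x
    let ?a = "norm (cadjoint T x)"
    have "?a * ?a = Re (cinner (cadjoint T x) (cadjoint T x))"
      by (simp add: cinner_self power2_eq_square)
    also have "\<dots> = Re (cinner (T (cadjoint T x)) x)"
      by (simp add: cinner_cadjoint[OF T])
    also have "\<dots> \<le> norm (T (cadjoint T x)) * norm x"
      by (rule Re_cinner_le)
    also have "\<dots> \<le> K * ?a * norm x"
      using K by (intro mult_right_mono) auto
    finally have "?a * ?a \<le> ?a * (K * norm x)" by (simp add: mult_ac)
    then show "?a \<le> K * norm x"
      using K(1) by (cases "?a = 0") (auto simp: mult_le_cancel_left)
  qed
qed


section \<open>Polynomials in an operator\<close>

text \<open>The operator \<open>p(T)\<close> in Horner form, so that proofs go by induction over
  \<open>pCons\<close>.\<close>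

definition polyop :: "('a::complex_vector \<Rightarrow> 'a) \<Rightarrow> complex poly \<Rightarrow> 'a \<Rightarrow> 'a"
  where "polyop T p = fold_coeffs (\<lambda>a f h. a *\<^sub>C h + T (f h)) p (\<lambda>h. 0)"

lemma polyop_0 [simp]: "polyop T 0 h = 0"
  by (simp add: polyop_def)

context
  fixes T :: "'a::complex_hilbert_space \<Rightarrow> 'a"
  assumes T: "bounded_clinear T"
begin

lemma polyop_pCons [simp]: "polyop T (pCons a p) h = a *\<^sub>C h + T (polyop T p h)"
  by (cases "a = 0 \<and> p = 0") (auto simp: polyop_def bounded_clinear_zero[OF T])

lemma bounded_clinear_polyop: "bounded_clinear (polyop T p)"
proof (induction p)
  case 0
  have "polyop T 0 = (\<lambda>x. 0)" by (simp add: fun_eq_iff)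
  then show ?case by (simp only: bounded_clinear_zero_map)
next
  case (pCons a p)
  have "polyop T (pCons a p) = (\<lambda>h. a *\<^sub>C h + T (polyop T p h))" by (simp add: fun_eq_iff)
  then show ?case
    by (simp only: bounded_clinear_add_map bounded_clinear_compose T pCons.IH
        bounded_clinear_scale_map)
qed

lemma polyop_commute: "polyop T p (T h) = T (polyop T p h)"
  by (induction p) (auto simp: bounded_clinear_simps[OF T])

lemma polyop_add: "polyop T (p + q) h = polyop T p h + polyop T q h"
  by (induction p q rule: poly_induct2)
    (auto simp: bounded_clinear_simps[OF T] scaleC_add_left algebra_simps)

lemma polyop_smult: "polyop T (smult c p) h = c *\<^sub>C polyop T p h"
  by (induction p) (auto simp: bounded_clinear_simps[OF T] scaleC_add_right)

lemma polyop_mult: "polyop T (p * q) h = polyop T p (polyop T q h)"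
  by (induction p) (auto simp: polyop_add polyop_smult)

lemma polyop_monom: "polyop T (monom c n) h = c *\<^sub>C (T ^^ n) h"
  by (induction n) (auto simp: monom_0 monom_Suc bounded_clinear_simps[OF T])

lemma polyop_sum: "polyop T (sum f A) h = (\<Sum>i\<in>A. polyop T (f i) h)"
  by (induction A rule: infinite_finite_induct) (auto simp: polyop_add)

section \<open>Polynomials mapping the space into the kernel of a finite-rank operator\<close>

lemma polyop_invariant:
  assumes D: "bounded_clinear D" and inv: "\<And>x. D x = 0 \<Longrightarrow> D (T x) = 0" and "D x = 0"
  shows "D (polyop T p x) = 0"
  using assms(3) by (induction p) (auto simp: bounded_clinear_simps[OF D] inv)

text \<open>The vectors \<open>D (T^k h)\<close> lie in a finite-dimensional space; the coefficients
  of a linear relation among them form \<open>p\<close>.\<close>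

lemma polyop_annihilates_vector:
  assumes D: "bounded_clinear D" and B: "finite B" "range D \<subseteq> cspan B"
  shows "\<exists>p. p \<noteq> 0 \<and> D (polyop T p h) = 0"
proof -
  define v where "v k = D ((T ^^ k) h)" for k
  show ?thesis
  proof (cases "inj v")
    \<comment> \<open>Dependence is a property of sets of vectors. Injectivity of \<open>v\<close>
      turns a relation on its range into coefficients indexed by exponents.\<close>
    case True
    then have "infinite (range v)"
      using finite_imageD infinite_UNIV_nat by blast
    moreover have "range v \<subseteq> cspan B"
      using B(2) by (auto simp: v_def)
    ultimately have "complex_vector.dependent (range v)"
      using complex_vector.independent_span_bound[OF B(1)] by blast
    then obtain t u w where t: "finite t" "t \<subseteq> range v" "(\<Sum>x\<in>t. u x *\<^sub>C x) = 0"
      and w: "w \<in> t" "u w \<noteq> 0"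
      unfolding complex_vector.dependent_explicit by blast
    define K where "K = v -` t"
    have K: "finite K" "v ` K = t"
      using t True by (auto simp: K_def finite_vimageI)
    obtain k where k: "k \<in> K" "w = v k"
      using w K by blast
    define p where "p = (\<Sum>k\<in>K. monom (u (v k)) k)"
    have "coeff p k = u w"
      using k K by (simp add: p_def coeff_sum)
    with w have "p \<noteq> 0" by auto
    moreover have "D (polyop T p h) = (\<Sum>k\<in>K. u (v k) *\<^sub>C v k)"
      by (simp add: p_def polyop_sum polyop_monom bounded_clinear_sum[OF D]
          bounded_clinear_scaleC[OF D] v_def)
    then have "D (polyop T p h) = 0"
      using t(3) sum.reindex[of v K "\<lambda>x. u x *\<^sub>C x"] True K by (simp add: inj_on_def inj_def)
    ultimately show ?thesis by blast
  next
    case False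
    then obtain i j where ij: "i \<noteq> j" "v i = v j"
      by (auto simp: inj_def)
    \<comment> \<open>A repetition \<open>v i = v j\<close> is itself a relation, with polynomial
      \<open>X^i - X^j\<close>.\<close>
    let ?p = "monom 1 i + monom (-1) j :: complex poly"
    have "coeff ?p i = 1"
      using ij by simp
    then have "?p \<noteq> 0" by (metis coeff_0 zero_neq_one)
    moreover have "D (polyop T ?p h) = 0"
      using ij by (simp add: polyop_add polyop_monom bounded_clinear_simps[OF D] scaleC_one v_def)
    ultimately show ?thesis by blast
  qed
qed

text \<open>Polynomials for single vectors are multiplied: the factors commute, and once one of them
  has sent a vector into the kernel of \<open>D\<close>, the other keeps it there.\<close>

lemma polyop_annihilates_finite:
  assumes D: "bounded_clinear D" "finite B" "range D \<subseteq> cspan B"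
    and inv: "\<And>x. D x = 0 \<Longrightarrow> D (T x) = 0" and "finite A"
  shows "\<exists>p. p \<noteq> 0 \<and> (\<forall>h\<in>A. D (polyop T p h) = 0)"
  using \<open>finite A\<close>
proof induction
  case empty
  have "(1::complex poly) \<noteq> 0" by simp
  then show ?case by blast
next
  case (insert h A)
  then obtain p where p: "p \<noteq> 0" "\<forall>h\<in>A. D (polyop T p h) = 0" by blast
  obtain q where q: "q \<noteq> 0" "D (polyop T q h) = 0"
    using polyop_annihilates_vector[OF D] by blast
  have "D (polyop T (p * q) x) = 0" if x: "x \<in> insert h A" for x
  proof (cases "x = h")
    case True
    then show ?thesis
      using q(2) by (simp only: polyop_mult polyop_invariant[OF D(1) inv])
  next
    case False
    with x p(2) have "D (polyop T p x) = 0" by simp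
    then show ?thesis
      by (simp only: mult.commute[of p q] polyop_mult polyop_invariant[OF D(1) inv])
  qed
  moreover have "p * q \<noteq> 0"
    using p(1) q(1) by simp
  ultimately show ?case by blast
qed

text \<open>Choose a finite \<open>A\<close> whose image under \<open>D\<close> spans the range of
  \<open>D\<close>. Every \<open>h\<close> differs from a vector in the span of \<open>A\<close> by
  a vector in the kernel of \<open>D\<close>; linearity handles the first and invariance the
  second.\<close>

lemma polyop_annihilates:
  assumes D: "bounded_clinear D" "finite_rank D"
    and inv: "\<And>x. D x = 0 \<Longrightarrow> D (T x) = 0"
  obtains p where "p \<noteq> 0" "\<And>h. D (polyop T p h) = 0"
proof -
  obtain B where B: "finite B" "range D \<subseteq> cspan B"
    using D(2) by (auto simp: finite_rank_def)
  \<comment> \<open>\<open>B\<close> may stick out of the range of \<open>D\<close>; the elements of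
    \<open>C\<close> have preimages.\<close>
  obtain C where C: "C \<subseteq> range D" "complex_vector.independent C" "range D \<subseteq> cspan C"
    using complex_vector.maximal_independent_subset by blast
  have "finite C"
    using complex_vector.independent_span_bound[OF B(1) C(2)] C(1) B(2) by blast
  then obtain A where A: "finite A" "C = D ` A"
    using finite_subset_image C(1) by metis
  obtain p where p: "p \<noteq> 0" "\<forall>h\<in>A. D (polyop T p h) = 0"
    using polyop_annihilates_finite[OF D(1) B inv A(1)] by blast
  have Dp: "bounded_clinear (\<lambda>x. D (polyop T p x))"
    by (rule bounded_clinear_compose[OF D(1) bounded_clinear_polyop])
  have "csubspace {x. D (polyop T p x) = 0}"
    by (simp add: complex_vector.subspace_def bounded_clinear_simps[OF Dp])
  then have span: "cspan A \<subseteq> {x. D (polyop T p x) = 0}"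
    using p(2) by (intro complex_vector.span_minimal) auto
  interpret D: Vector_Spaces.linear scaleC scaleC D
    by (rule linear_bounded_clinear[OF D(1)])
  have "D (polyop T p h) = 0" for h
  proof -
    have "D h \<in> D ` cspan A"
      using C(3) A(2) D.span_image[of A] by auto
    then obtain a where a: "a \<in> cspan A" "D h = D a" by blast
    then have "D (polyop T p (h - a)) = 0"
      by (intro polyop_invariant[OF D(1) inv]) (simp_all add: bounded_clinear_diff[OF D(1)])
    moreover have "D (polyop T p a) = 0"
      using span a(1) by blast
    ultimately show ?thesis
      by (simp only: bounded_clinear_diff[OF Dp] diff_zero)
  qed
  with p(1) show ?thesis by (rule that)
qed

text \<open>A nonconstant complex polynomial has a linear factor \<open>X - c\<close>. By
  \<open>eig\<close> the operator \<open>T - c\<close> is injective, so this factor cancels and the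
  degree drops.\<close>

lemma polyop_eq_0D:
  assumes eig: "\<And>c x. T x = c *\<^sub>C x \<Longrightarrow> x = 0"
  shows "p \<noteq> 0 \<Longrightarrow> polyop T p x = 0 \<Longrightarrow> x = 0"
proof (induction "degree p" arbitrary: p rule: less_induct)
  case less
  show ?case
  proof (cases "degree p = 0")
    case True
    then obtain a where "p = [:a:]" by (rule degree_eq_zeroE)
    with less.prems show ?thesis by (simp add: bounded_clinear_zero[OF T])
  next
    case False
    then obtain c where "poly p c = 0"
      using fundamental_theorem_of_algebra[of p] by (auto simp: constant_degree)
    then obtain q where q: "p = [:-c, 1:] * q"
      by (auto simp: poly_eq_0_iff_dvd dvd_def)
    have "q \<noteq> 0" using q less.prems by auto
    then have "degree p = degree [:-c, 1:] + degree q"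
      unfolding q by (intro degree_mult_eq) auto
    then have "degree q < degree p" by simp
    have "polyop T [:-c, 1:] (polyop T q x) = 0"
      using less.prems q by (simp only: polyop_mult)
    then have "T (polyop T q x) = c *\<^sub>C polyop T q x"
      by (simp add: bounded_clinear_zero[OF T] scaleC_one)
    then have "polyop T q x = 0" by (rule eig)
    with \<open>degree q < degree p\<close> \<open>q \<noteq> 0\<close> show ?thesis
      using less.hyps by blast
  qed
qed

text \<open>\<open>T\<close> is algebraic, since \<open>(1 - X) p\<close> annihilates it for some
  nonzero \<open>p\<close>. If \<open>a + X r\<close> annihilates it with least degree, then
  injectivity forces \<open>a \<noteq> 0\<close>, and \<open>-r(T)/a\<close> inverts
  \<open>T\<close>.\<close>

lemma finite_rank_perturbation_left_inverse:
  assumes inj: "\<And>x. T x = 0 \<Longrightarrow> x = 0" and fin: "finite_rank (\<lambda>h. h - T h)"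
  obtains R where "bounded_clinear R" "\<And>h. R (T h) = h"
proof -
  have D: "bounded_clinear (\<lambda>h. h - T h)"
    by (rule bounded_clinear_diff_map[OF bounded_clinear_id T])
  have "T x - T (T x) = 0" if "x - T x = 0" for x
    using that by simp
  then obtain p where p: "p \<noteq> 0" "\<And>h. polyop T p h - T (polyop T p h) = 0"
    using polyop_annihilates[OF D fin] by blast
  have "polyop T ([:1, -1:] * p) h = 0" for h
    using p(2)[of h] unfolding polyop_mult
    by (simp add: bounded_clinear_zero[OF T] bounded_clinear_minus[OF T] scaleC_one)
  moreover have "[:1, -1:] * p \<noteq> 0"
    using p(1) by (simp only: mult_eq_0_iff) simp
  ultimately have "[:1, -1:] * p \<noteq> 0 \<and> (\<forall>h. polyop T ([:1, -1:] * p) h = 0)"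
    by blast
  from ex_has_least_nat[of "\<lambda>q. q \<noteq> 0 \<and> (\<forall>h. polyop T q h = 0)", OF this, of degree]
  obtain q where q: "q \<noteq> 0" "\<And>h. polyop T q h = 0"
    and min: "\<And>r. r \<noteq> 0 \<Longrightarrow> (\<And>h. polyop T r h = 0) \<Longrightarrow> degree q \<le> degree r"
    by blast
  obtain a r where qr: "q = pCons a r" by (rule pCons_cases)
  \<comment> \<open>If \<open>a = 0\<close>, then \<open>T (r(T) h) = 0\<close> for all
    \<open>h\<close>, so by injectivity \<open>r\<close> is an annihilating polynomial of smaller
    degree.\<close>
  have "a \<noteq> 0"
  proof
    assume "a = 0"
    with q qr have "r \<noteq> 0" "\<And>h. polyop T r h = 0"
      using inj by auto
    then have "degree q \<le> degree r" by (rule min)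
    with qr \<open>r \<noteq> 0\<close> show False by simp
  qed
  define R where "R h = (- 1 / a) *\<^sub>C polyop T r h" for h
  have "bounded_clinear R"
    unfolding R_def[abs_def]
    by (rule bounded_clinear_compose[OF bounded_clinear_scale_map bounded_clinear_polyop])
  moreover have "R (T h) = h" for h
  proof -
    have "T (polyop T r h) = (- a) *\<^sub>C h"
      using q(2)[of h] qr by (simp add: eq_neg_iff_add_eq_0 add.commute)
    then show ?thesis
      using \<open>a \<noteq> 0\<close> by (simp add: R_def polyop_commute scaleC_one)
  qed
  ultimately show ?thesis by (rule that)
qed

end


section \<open>Vector-valued power series with bounded coefficients\<close>

definition powser :: "(nat \<Rightarrow> 'a::complex_hilbert_space) \<Rightarrow> complex \<Rightarrow> 'a"
  where "powser a z = (\<Sum>n. z ^ n *\<^sub>C a n)"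

text \<open>Comparison with the geometric series. The explicit bound serves twice: for the
  coefficients of difference quotients, and for continuity of the evaluation maps.\<close>

lemma
  assumes a: "\<forall>n. norm (a n :: 'a::complex_hilbert_space) \<le> K" and z: "cmod z < 1"
  shows summable_powser: "summable (\<lambda>n. z ^ n *\<^sub>C a n)"
    and norm_powser_le: "norm (powser a z) \<le> K / (1 - cmod z)"
proof -
  have le: "norm (z ^ n *\<^sub>C a n) \<le> K * cmod z ^ n" for n
    using mult_left_mono[OF a[rule_format, of n] zero_le_power[of "cmod z" n]]
    by (simp add: norm_power mult.commute)
  have geo: "summable (\<lambda>n. cmod z ^ n)" "suminf (\<lambda>n. cmod z ^ n) = 1 / (1 - cmod z)"
    using z by (auto intro: summable_geometric suminf_geometric)
  show "summable (\<lambda>n. z ^ n *\<^sub>C a n)"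
    by (rule summable_comparison_test'[OF summable_mult[OF geo(1)] le])
  have "norm (powser a z) \<le> (\<Sum>n. K * cmod z ^ n)"
    unfolding powser_def by (rule norm_suminf_le[OF le summable_mult[OF geo(1)]])
  also have "\<dots> = K / (1 - cmod z)"
    by (subst suminf_mult[OF geo(1)]) (simp add: geo(2))
  finally show "norm (powser a z) \<le> K / (1 - cmod z)" .
qed

lemma powser_Suc:
  assumes a: "\<forall>n. norm (a n) \<le> K" and z: "cmod z < 1"
  shows "powser a z = a 0 + z *\<^sub>C powser (\<lambda>n. a (Suc n)) z"
proof -
  have "powser a z = a 0 + (\<Sum>n. z *\<^sub>C (z ^ n *\<^sub>C a (Suc n)))"
    using suminf_split_head[OF summable_powser[OF a z]]
    by (simp add: powser_def scaleC_one scaleC_scaleC)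
  also have "(\<Sum>n. z *\<^sub>C (z ^ n *\<^sub>C a (Suc n))) = z *\<^sub>C powser (\<lambda>n. a (Suc n)) z"
    unfolding powser_def
    by (rule bounded_linear.suminf[OF bounded_linear_scaleC_right, symmetric])
      (use a in \<open>auto intro: summable_powser[OF _ z]\<close>)
  finally show ?thesis .
qed

lemma powser_add:
  assumes "\<forall>n. norm (a n) \<le> K" "\<forall>n. norm (b n) \<le> L" "cmod z < 1"
  shows "powser (\<lambda>n. a n + b n) z = powser a z + powser b z"
  unfolding powser_def
  by (simp add: scaleC_add_right suminf_add summable_powser[OF assms(1,3)]
      summable_powser[OF assms(2,3)])

lemma powser_scaleC:
  assumes "\<forall>n. norm (a n) \<le> K" "cmod z < 1"
  shows "powser (\<lambda>n. c *\<^sub>C a n) z = c *\<^sub>C powser a z"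
  unfolding powser_def
  by (subst bounded_linear.suminf[OF bounded_linear_scaleC_right summable_powser[OF assms]])
    (simp add: scaleC_scaleC mult.commute)

text \<open>The difference quotient of a power series at \<open>w\<close> is again a power series in \<open>z\<close>, with
  coefficients \<open>b n = \<Sum>j. w^j a (n + 1 + j)\<close>, so differentiability reduces to continuity.\<close>

lemma powser_difference:
  assumes a: "\<forall>n. norm (a n) \<le> K" and w: "cmod w < 1" and z: "cmod z < 1"
  shows "powser a z - powser a w = (z - w) *\<^sub>C powser (\<lambda>n. powser (\<lambda>j. a (Suc n + j)) w) z"
proof -
  define c where "c n = powser (\<lambda>j. a (n + j)) w" for n
  have c: "\<forall>n. norm (c n) \<le> K / (1 - cmod w)"
    unfolding c_def using a by (auto intro: norm_powser_le[OF _ w])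
  have rec: "c n = a n + w *\<^sub>C c (Suc n)" for n
    unfolding c_def using a by (subst powser_Suc[OF _ w]) auto
  have wc: "\<forall>n. norm (w *\<^sub>C c (Suc n)) \<le> 1 * (K / (1 - cmod w))"
    unfolding norm_scaleC using c w by (intro allI mult_mono) auto
  \<comment> \<open>The series of \<open>c\<close> is expanded in two ways, by the recursion and by
    splitting off its first term; comparing them produces the factor \<open>z - w\<close>.\<close>
  have "powser c z = powser (\<lambda>n. a n + w *\<^sub>C c (Suc n)) z"
    by (rule arg_cong[where f = "\<lambda>c. powser c z"]) (rule ext, rule rec)
  also have "\<dots> = powser a z + w *\<^sub>C powser (\<lambda>n. c (Suc n)) z"
  proof -
    have "\<forall>n. norm (c (Suc n)) \<le> K / (1 - cmod w)"
      using c by simp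
    from powser_scaleC[OF this z] show ?thesis
      by (simp add: powser_add[OF a wc z])
  qed
  also have "powser c z = c 0 + z *\<^sub>C powser (\<lambda>n. c (Suc n)) z"
    by (rule powser_Suc[OF c z])
  finally have "powser a z - c 0 = (z - w) *\<^sub>C powser (\<lambda>n. c (Suc n)) z"
    by (simp add: complex_vector.scale_left_diff_distrib algebra_simps)
  then show ?thesis
    by (simp add: c_def)
qed

lemma powser_tendsto:
  assumes a: "\<forall>n. norm (a n) \<le> K" and w: "cmod w < 1"
  shows "(powser a \<longlongrightarrow> powser a w) (at w)"
proof -
  have ev: "\<forall>\<^sub>F z in at w. cmod z < 1"
    by (rule order_tendstoD(2)[OF _ w]) (intro tendsto_intros)
  define L where "L = K / (1 - cmod w)"
  have "norm (powser a z - powser a w) \<le> cmod (z - w) * (L / (1 - cmod z))" if "cmod z < 1" for z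
  proof -
    have "\<forall>n. norm (powser (\<lambda>j. a (Suc n + j)) w) \<le> L"
      unfolding L_def using a by (auto intro: norm_powser_le[OF _ w])
    from norm_powser_le[OF this that] show ?thesis
      unfolding powser_difference[OF a w that] norm_scaleC by (intro mult_left_mono) auto
  qed
  then have le: "\<forall>\<^sub>F z in at w. norm (powser a z - powser a w) \<le> cmod (z - w) * (L / (1 - cmod z))"
    using ev by (auto elim: eventually_mono)
  have "((\<lambda>z. cmod (z - w) * (L / (1 - cmod z))) \<longlongrightarrow> cmod (w - w) * (L / (1 - cmod w))) (at w)"
    using w by (intro tendsto_intros) auto
  then have "((\<lambda>z. cmod (z - w) * (L / (1 - cmod z))) \<longlongrightarrow> 0) (at w)"
    by simp
  then show ?thesis
    using Lim_null_comparison[OF le] Lim_null by blast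
qed

lemma powser_analytic:
  assumes a: "\<forall>n. norm (a n) \<le> K"
  shows "analytic_on_disc (\<lambda>z. if z \<in> unit_disc then powser a z else 0)"
  unfolding analytic_on_disc_def
proof
  fix w assume "w \<in> unit_disc"
  then have w: "cmod w < 1" by simp
  define b where "b = (\<lambda>n. powser (\<lambda>j. a (Suc n + j)) w)"
  have b: "\<forall>n. norm (b n) \<le> K / (1 - cmod w)"
    unfolding b_def using a by (auto intro: norm_powser_le[OF _ w])
  let ?f = "\<lambda>z. if z \<in> unit_disc then powser a z else 0"
  \<comment> \<open>The disc is open, so the extension by zero does not affect the limit at
    \<open>w\<close>.\<close>
  have ev: "\<forall>\<^sub>F z in at w. cmod z < 1"
    by (rule order_tendstoD(2)[OF _ w]) (intro tendsto_intros)
  have quotient: "powser b z = (1 / (z - w)) *\<^sub>C (?f z - ?f w)" if "cmod z < 1" "z \<noteq> w" for z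
    using that w powser_difference[OF a w that(1)]
    by (simp add: b_def scaleC_scaleC scaleC_one)
  have "\<forall>\<^sub>F z in at w. powser b z = (1 / (z - w)) *\<^sub>C (?f z - ?f w)"
    using ev eventually_neq_at_within[of w w UNIV] by eventually_elim (rule quotient)
  from Lim_transform_eventually[OF powser_tendsto[OF b w] this]
  show "\<exists>d. ((\<lambda>z. (1 / (z - w)) *\<^sub>C (?f z - ?f w)) \<longlongrightarrow> d) (at w)" ..
qed

text \<open>Evaluation at 0 gives the first coefficient. After division by \<open>z\<close> the
  shifted series vanishes off 0, hence by continuity also at 0, and the induction continues with
  it.\<close>

lemma powser_eq_0D:
  assumes "\<forall>n. norm (a n) \<le> K" "\<And>z. cmod z < 1 \<Longrightarrow> powser a z = 0"
  shows "a n = 0"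
  using assms
proof (induction n arbitrary: a)
  case 0
  then show ?case
    using powser_Suc[of a K 0] by simp
next
  case (Suc n)
  note a = Suc.prems(1)
  define b where "b = (\<lambda>n. a (Suc n))"
  have b: "\<forall>n. norm (b n) \<le> K"
    using a by (simp add: b_def)
  have "a 0 = 0"
    using powser_Suc[of a K 0] Suc.prems by simp
  have nonzero: "powser b z = 0" if "cmod z < 1" "z \<noteq> 0" for z
  proof -
    have "z *\<^sub>C powser b z = powser a z"
      using powser_Suc[OF a that(1)] \<open>a 0 = 0\<close> by (simp add: b_def)
    also have "\<dots> = 0"
      by (rule Suc.prems(2)[OF that(1)])
    finally show ?thesis
      using that(2) by simp
  qed
  have "\<forall>\<^sub>F z in at 0. cmod z < 1"
    by (rule order_tendstoD(2)[of _ 0]) (auto intro!: tendsto_eq_intros)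
  then have "\<forall>\<^sub>F z in at 0. powser b z = 0"
    using eventually_neq_at_within[of 0 0 UNIV] by eventually_elim (rule nonzero)
  from Lim_transform_eventually[OF powser_tendsto[OF b] this]
  have "((\<lambda>z. 0) \<longlongrightarrow> powser b 0) (at (0::complex))"
    by simp
  then have "powser b 0 = 0"
    using tendsto_unique[OF _ _ tendsto_const] trivial_limit_at by blast
  with nonzero have "powser b z = 0" if "cmod z < 1" for z
    using that by (cases "z = 0") auto
  with Suc.IH[of b] b show ?case
    by (simp add: b_def)
qed


section \<open>Function models of an operator\<close>

text \<open>Transport of structure: the range of an injective \<open>U\<close> receives the inner
  product of the original space, which makes \<open>U\<close> unitary by construction. Completeness,
  contractivity and the left inverse are carried over along \<open>U\<close>.\<close>

lemma analytic_shift_model: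
  fixes T :: "'a::complex_hilbert_space \<Rightarrow> 'a" and U :: "'a \<Rightarrow> complex \<Rightarrow> 'a"
  assumes T: "contraction T" and R: "bounded_clinear R" "\<And>h. R (T h) = h"
    and add: "\<And>x y. U (x + y) = U x + U y" and scale: "\<And>c x. U (c *\<^sub>C x) = c *\<^sub>C U x"
    and inj: "\<And>h. U h = 0 \<Longrightarrow> h = 0"
    and outside: "\<And>h z. z \<notin> unit_disc \<Longrightarrow> U h z = 0"
    and analytic: "\<And>h. analytic_on_disc (U h)"
    and eval: "\<And>w. w \<in> unit_disc \<Longrightarrow> \<exists>K. \<forall>h. norm (U h w) \<le> K * norm h"
    and shift: "\<And>h. U (T h) = mult_z (U h)"
  shows "\<exists>(E :: 'a set) (F :: (complex \<Rightarrow> 'a) set) ip U.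
    rkhs E F ip \<and> mult_z_analytic_shift F ip \<and>
    unitary_onto U F ip \<and> (\<forall>h. U (T h) = mult_z (U h))"
proof -
  have diff: "U (x - y) = U x - U y" for x y
    using add[of "x - y" y] by (simp add: eq_diff_eq)
  have zero: "U 0 = 0"
    using diff[of 0 0] by simp
  have "inj U"
  proof (rule injI)
    fix x y assume "U x = U y"
    then have "x - y = 0" by (intro inj) (simp add: diff)
    then show "x = y" by simp
  qed
  define F where "F = range U"
  define G where "G = inv U"
  define ip where "ip f g = cinner (G f) (G g)" for f g
  have GU: "G (U x) = x" for x
    using \<open>inj U\<close> by (simp add: G_def)
  have ip: "ip (U x) (U y) = cinner x y" for x y
    by (simp add: ip_def GU)
  have ip_norm: "ip_norm ip (U x) = norm x" for x
    by (simp add: ip_norm_def ip cinner_self)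
  have unitary: "unitary_onto U F ip"
    by (simp add: unitary_onto_def add scale ip F_def)
  have "csubspace F"
    unfolding complex_vector.subspace_def F_def
    by (auto simp flip: zero add scale)
  moreover have "inner_product_on F ip"
  proof -
    have "Re (cinner x x) > 0" if "U x \<noteq> 0" for x
      using that zero by (cases "x = 0") (auto simp: cinner_self)
    then show ?thesis
      unfolding inner_product_on_def F_def
      by (auto simp: ip cinner_add_left cinner_scaleC_left intro: cinner_commute
          simp flip: add scale)
  qed
  moreover have "complete_on F ip"
    unfolding complete_on_def
  proof (intro allI impI, elim conjE)
    fix s :: "nat \<Rightarrow> complex \<Rightarrow> 'a"
    assume s: "\<forall>n. s n \<in> F" and
      cauchy: "\<forall>e>0. \<exists>N. \<forall>m\<ge>N. \<forall>n\<ge>N. ip_norm ip (s m - s n) < e"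
    from s obtain t where t: "s = (\<lambda>n. U (t n))"
      unfolding F_def image_iff fun_eq_iff by metis
    have "Cauchy t"
      using cauchy by (simp add: Cauchy_def t dist_norm ip_norm flip: diff)
    then obtain x where "t \<longlonglongrightarrow> x"
      using Cauchy_convergent convergent_def by blast
    then have "(\<lambda>n. norm (t n - x)) \<longlonglongrightarrow> 0"
      using LIM_zero tendsto_norm_zero by blast
    then show "\<exists>f\<in>F. (\<lambda>n. ip_norm ip (s n - f)) \<longlonglongrightarrow> 0"
      by (intro bexI[of _ "U x"]) (auto simp: F_def t ip_norm simp flip: diff)
  qed
  moreover have "\<exists>d>0. \<forall>g\<in>F. ip_norm ip (g - f) < d \<longrightarrow> norm (g w - f w) < e"
    if w: "w \<in> unit_disc" and "f \<in> F" "0 < e" for w f and e :: real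
  proof -
    obtain K where K: "\<And>h. norm (U h w) \<le> K * norm h"
      using eval[OF w] by blast
    obtain x where x: "f = U x" using \<open>f \<in> F\<close> by (auto simp: F_def)
    \<comment> \<open>\<open>\<bar>K\<bar> + 1\<close> is a positive divisor whatever the sign of
      \<open>K\<close>.\<close>
    have "norm (U y w - f w) < e" if "ip_norm ip (U y - f) < e / (\<bar>K\<bar> + 1)" for y
    proof -
      have "norm (U y w - f w) \<le> K * norm (y - x)"
        using K[of "y - x"] by (simp add: x diff)
      also have "\<dots> \<le> (\<bar>K\<bar> + 1) * norm (y - x)"
        by (intro mult_right_mono) auto
      also have "\<dots> < e"
        using that by (simp add: x ip_norm field_simps add_pos_nonneg flip: diff)
      finally show ?thesis .
    qed
    then show ?thesis
      using \<open>0 < e\<close> by (intro exI[of _ "e / (\<bar>K\<bar> + 1)"]) (auto simp: F_def)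
  qed
  ultimately have "rkhs UNIV F ip"
    unfolding rkhs_def hilbert_space_on_def
    by (auto simp: F_def outside analytic)
  moreover have "mult_z_analytic_shift F ip"
  proof -
    obtain K where K: "\<And>x. norm (R x) \<le> K * norm x"
      using bounded_clinear_bound[OF R(1)] by blast
    \<comment> \<open>The left inverse of multiplication by \<open>z\<close> is \<open>R\<close>
      conjugated by \<open>U\<close>.\<close>
    have "bounded_op_on F ip (\<lambda>f. U (R (G f)))"
      unfolding bounded_op_on_def F_def
      using K by (auto simp: GU ip_norm bounded_clinear_simps[OF R(1)] simp flip: add scale)
    moreover have "U (R (G (mult_z f))) = f" if "f \<in> F" for f
      using that by (auto simp: F_def GU R(2) simp flip: shift)
    ultimately have "\<exists>L. bounded_op_on F ip L \<and> (\<forall>f\<in>F. L (mult_z f) = f)"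
      by blast
    moreover have "mult_z ` F \<subseteq> F" "\<forall>f\<in>F. ip_norm ip (mult_z f) \<le> ip_norm ip f"
      using T by (auto simp: F_def ip_norm contraction_def simp flip: shift)
    ultimately show ?thesis
      by (simp add: mult_z_analytic_shift_def)
  qed
  ultimately show ?thesis
    using unitary shift by blast
qed


section \<open>Pure finite isometries\<close>

locale pure_finite_isometry =
  fixes T :: "'a::complex_hilbert_space \<Rightarrow> 'a"
  assumes T: "bounded_clinear T"
    and pure: "pure_hyponormal T"
    and finite: "finite_isometry T"
begin

section \<open>The adjoint, norm estimates and the vectors on which \<open>T\<close> is
  isometric\<close>

abbreviation "S \<equiv> cadjoint T"

lemma S: "bounded_clinear S"
  by (rule bounded_clinear_cadjoint[OF T])

lemma cinner_T: "cinner (T x) y = cinner x (S y)"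
  by (rule cinner_cadjoint[OF T])

lemma cinner_S: "cinner (S x) y = cinner x (T y)"
  by (rule cinner_cadjoint_left[OF T])

lemma norm_T_le: "norm (T h) \<le> norm h"
  using finite by (simp add: finite_isometry_def contraction_def)

text \<open>Hyponormality in norm form: the quadratic form of \<open>S T - T S\<close> at
  \<open>h\<close> is \<open>(norm (T h))^2 - (norm (S h))^2\<close>.\<close>

lemma norm_S_le_T: "norm (S h) \<le> norm (T h)"
proof -
  have "cinner (S (T h) - T (S h)) h \<in> \<real>\<^sub>\<ge>\<^sub>0"
    using finite by (simp add: finite_isometry_def hyponormal_def op_le_def)
  then have "0 \<le> Re (cinner (S (T h) - T (S h)) h)"
    by (simp add: complex_nonneg_Reals_iff)
  then have "(norm (S h))\<^sup>2 \<le> (norm (T h))\<^sup>2"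
    by (simp add: cinner_diff_left cinner_S cinner_T cinner_self)
  then show ?thesis
    by (rule power2_le_imp_le) simp
qed

lemma norm_S_le: "norm (S h) \<le> norm h"
  using norm_S_le_T norm_T_le order_trans by blast

lemma norm_funpow_S_le: "norm ((S ^^ n) h) \<le> norm h"
  by (induction n) (auto intro: order_trans[OF norm_S_le])

text \<open>If the norm is preserved at \<open>h\<close>, expanding gives
  \<open>(norm (S (T h) - h))^2 = (norm (S (T h)))^2 - (norm h)^2\<close>, which is at most 0
  because \<open>S\<close> is a contraction.\<close>

lemma S_T_eq_iff: "S (T h) = h \<longleftrightarrow> norm (T h) = norm h"
proof
  assume "S (T h) = h"
  then have "(norm (T h))\<^sup>2 = (norm h)\<^sup>2"
    using cinner_T[of h "T h"] by (simp add: cinner_self flip: of_real_power)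
  then show "norm (T h) = norm h"
    by (simp add: power2_eq_iff_nonneg)
next
  assume eq: "norm (T h) = norm h"
  have "Re (cinner (S (T h)) h) = (norm (T h))\<^sup>2"
    by (simp add: cinner_S cinner_self)
  then have "(norm (S (T h) - h))\<^sup>2 = (norm (S (T h)))\<^sup>2 - (norm h)\<^sup>2"
    by (simp add: norm_diff_squared eq)
  also have "\<dots> \<le> 0"
    using norm_S_le[of "T h"] eq by (simp add: power_mono)
  finally show "S (T h) = h" by simp
qed

text \<open>Hyponormality enters here: if \<open>\<parallel>T h\<parallel> = \<parallel>h\<parallel>\<close> then
  \<open>\<parallel>T (T h)\<parallel> \<ge> \<parallel>S (T h)\<parallel> = \<parallel>h\<parallel> = \<parallel>T h\<parallel>\<close>.\<close>

lemma S_T_invariant: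
  assumes "S (T h) = h"
  shows "S (T (T h)) = T h"
  unfolding S_T_eq_iff
  using assms norm_S_le_T[of "T h"] norm_T_le[of "T h"] norm_T_le[of h] by simp

text \<open>Invariance under \<open>T\<close> and \<open>S\<close> makes \<open>M\<close> reducing
  and makes \<open>S\<close> the adjoint of \<open>T\<close> within \<open>M\<close>, so commutation
  on \<open>M\<close> is normality of the restriction. Purity is applied in this form to eigenspaces
  and to the unitary part.\<close>

lemma pure_trivial:
  assumes M: "csubspace M" "closed M" and TM: "\<And>x. x \<in> M \<Longrightarrow> T x \<in> M"
    and SM: "\<And>x. x \<in> M \<Longrightarrow> S x \<in> M" and normal: "\<And>x. x \<in> M \<Longrightarrow> S (T x) = T (S x)"
    and "x \<in> M"
  shows "x = 0"
proof -
  have adj: "cadjoint_on M T y = S y" if "y \<in> M" for y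
    using that M SM by (intro cadjoint_on_eqI) (auto simp: cinner_T)
  have "reducing T M"
    using M TM SM by (auto simp: reducing_def ortho_compl_def cinner_T)
  moreover have "normal_on M T"
    using TM adj normal by (simp add: normal_on_def)
  ultimately have "M = {0}"
    using pure M(2) by (auto simp: pure_hyponormal_def)
  with \<open>x \<in> M\<close> show ?thesis by simp
qed

text \<open>On an eigenspace hyponormality forces \<open>S x = cnj c *\<^sub>C x\<close>, because
  the squared distance of the two sides is \<open>(norm (S x))^2 - (norm (T x))^2\<close>. The
  eigenspace then reduces \<open>T\<close> to a scalar, which is normal.\<close>

lemma no_eigenvectors:
  assumes "T x = c *\<^sub>C x"
  shows "x = 0"
proof -
  define M where "M = {x. T x = c *\<^sub>C x}"
  have eig: "S x = cnj c *\<^sub>C x" if "x \<in> M" for x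
  proof -
    have Tx: "T x = c *\<^sub>C x" using that by (simp add: M_def)
    have "cinner (S x) (cnj c *\<^sub>C x) = cinner (c *\<^sub>C x) (T x)"
      by (simp add: cinner_scaleC_right cinner_scaleC_left cinner_S)
    also have "\<dots> = complex_of_real ((norm (T x))\<^sup>2)"
      by (simp only: cinner_self flip: Tx)
    finally have "Re (cinner (S x) (cnj c *\<^sub>C x)) = (norm (T x))\<^sup>2"
      by simp
    moreover have "norm (cnj c *\<^sub>C x) = norm (T x)"
      by (simp add: Tx)
    ultimately have "(norm (S x - cnj c *\<^sub>C x))\<^sup>2 = (norm (S x))\<^sup>2 - (norm (T x))\<^sup>2"
      by (simp only: norm_diff_squared)
    also have "\<dots> \<le> 0"
      using norm_S_le_T[of x] by (simp add: power_mono)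
    finally show ?thesis by simp
  qed
  show ?thesis
  proof (rule pure_trivial[of M])
    show "csubspace M"
      by (auto simp: M_def complex_vector.subspace_def bounded_clinear_simps[OF T]
          scaleC_add_right scaleC_scaleC mult.commute)
    show "closed M"
      unfolding M_def
      by (intro closed_Collect_eq bounded_clinear_continuous_on T bounded_clinear_scale_map)
  next
    fix x assume x: "x \<in> M"
    then have Tx: "T x = c *\<^sub>C x" by (simp add: M_def)
    show "T x \<in> M"
      using Tx by (simp add: M_def bounded_clinear_scaleC[OF T])
    show "S x \<in> M"
      using Tx eig[OF x] by (simp add: M_def bounded_clinear_scaleC[OF T] scaleC_scaleC mult.commute)
    show "S (T x) = T (S x)"
      using Tx eig[OF x]
      by (simp add: bounded_clinear_scaleC[OF T] bounded_clinear_scaleC[OF S] scaleC_scaleC mult.commute)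
  qed (simp add: M_def assms)
qed

text \<open>For an isometry \<open>T\<close>, the map \<open>I - T S\<close> would be the projection
  onto the wandering subspace and these would be the coefficients of the Wold decomposition. They
  are bounded in \<open>n\<close>, so their power series converges on the whole disc.\<close>

definition wandering_coeff :: "'a \<Rightarrow> nat \<Rightarrow> 'a"
  where "wandering_coeff h n = (S ^^ n) h - T (S ((S ^^ n) h))"

lemma bounded_clinear_wandering_coeff: "bounded_clinear (\<lambda>h. wandering_coeff h n)"
  unfolding wandering_coeff_def
  by (rule bounded_clinear_diff_map[OF bounded_clinear_funpow[OF S]
        bounded_clinear_compose[OF T bounded_clinear_compose[OF S bounded_clinear_funpow[OF S]]]])

lemma norm_wandering_coeff_le: "\<forall>n. norm (wandering_coeff h n) \<le> 2 * norm h"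
proof
  fix n
  have "norm (wandering_coeff h n) \<le> norm ((S ^^ n) h) + norm (T (S ((S ^^ n) h)))"
    unfolding wandering_coeff_def by (rule norm_triangle_ineq4)
  also have "norm (T (S ((S ^^ n) h))) \<le> norm ((S ^^ n) h)"
    using norm_T_le norm_S_le order_trans by blast
  finally show "norm (wandering_coeff h n) \<le> 2 * norm h"
    using norm_funpow_S_le[of n h] by simp
qed

lemma wandering_coeff_S: "wandering_coeff (S h) n = wandering_coeff h (Suc n)"
  by (simp add: wandering_coeff_def flip: funpow_swap1)

text \<open>\<open>S\<close> shifts the coefficients backward. Where \<open>S (T h) = h\<close>,
  \<open>T\<close> therefore shifts them forward, with 0 entering in front.\<close>

lemma wandering_coeff_T_0: "S (T h) = h \<Longrightarrow> wandering_coeff (T h) 0 = 0"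
  by (simp add: wandering_coeff_def)

lemma wandering_coeff_T_Suc: "S (T h) = h \<Longrightarrow> wandering_coeff (T h) (Suc n) = wandering_coeff h n"
  by (metis wandering_coeff_S)

text \<open>The vectors considered here form the unitary part of the isometry \<open>T\<close> restricted to
  \<open>{h. S (T h) = h}\<close>; it reduces \<open>T\<close>.\<close>

lemma wandering_coeff_eq_0D:
  assumes "S (T x) = x" "\<And>n. wandering_coeff x n = 0"
  shows "x = 0"
proof -
  define M where "M = {x. S (T x) = x \<and> (\<forall>n. wandering_coeff x n = 0)}"
  \<comment> \<open>The coefficient of index 0 is \<open>x - T (S x)\<close>; its vanishing makes
    \<open>S\<close> a two-sided inverse of \<open>T\<close> on \<open>M\<close>.\<close>
  have TS: "T (S x) = x" if "x \<in> M" for x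
  proof -
    have "wandering_coeff x 0 = 0" using that by (simp add: M_def)
    then show ?thesis by (simp add: wandering_coeff_def)
  qed
  show ?thesis
  proof (rule pure_trivial[of M])
    show "csubspace M"
      by (auto simp: M_def complex_vector.subspace_def bounded_clinear_simps[OF T]
          bounded_clinear_simps[OF S] bounded_clinear_simps[OF bounded_clinear_wandering_coeff])
    show "closed M"
      unfolding M_def
      by (intro closed_Collect_conj closed_Collect_all closed_Collect_eq continuous_on_const
          continuous_on_id bounded_clinear_continuous_on bounded_clinear_wandering_coeff
          bounded_clinear_compose[OF S T])
  next
    fix x assume x: "x \<in> M"
    then have STx: "S (T x) = x" and coeff: "wandering_coeff x n = 0" for n
      by (auto simp: M_def)
    show "T x \<in> M"
    proof -
      have "wandering_coeff (T x) n = 0" for n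
        using STx coeff by (cases n) (auto simp: wandering_coeff_T_0 wandering_coeff_T_Suc)
      then show ?thesis
        using S_T_invariant[OF STx] by (simp add: M_def)
    qed
    show "S x \<in> M"
      using coeff TS[OF x] by (simp add: M_def wandering_coeff_S)
    show "S (T x) = T (S x)"
      using STx TS[OF x] by simp
  qed (use assms in \<open>simp add: M_def\<close>)
qed

text \<open>A vector in the kernel of \<open>S T\<close> lies in the kernel of \<open>T\<close>, so
  it would be an eigenvector for 0. Hence \<open>S T\<close> has a left inverse, and composing that
  with \<open>S\<close> gives one for \<open>T\<close>.\<close>

lemma bounded_left_inverse:
  obtains R where "bounded_clinear R" "\<And>h. R (T h) = h"
proof -
  have inj: "x = 0" if "S (T x) = 0" for x
  proof -
    have "cinner (T x) (T x) = 0"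
      using that by (simp add: cinner_T)
    then have "T x = 0"
      by (simp add: cinner_self)
    then show ?thesis
      by (intro no_eigenvectors[of x 0]) simp
  qed
  have "finite_rank (\<lambda>h. h - S (T h))"
    using finite by (simp add: finite_isometry_def)
  then obtain R where R: "bounded_clinear R" "\<And>h. R (S (T h)) = h"
    using finite_rank_perturbation_left_inverse[OF bounded_clinear_compose[OF S T] inj] by blast
  show ?thesis
    by (rule that[of "\<lambda>x. R (S x)"]) (use R in \<open>auto intro: bounded_clinear_compose[OF R(1) S]\<close>)
qed

text \<open>The kernel of \<open>I - S T\<close> is invariant under \<open>T\<close> and
  \<open>I - S T\<close> has finite rank, as the annihilation lemma requires.\<close>

lemma polynomial_into_isometric_part:
  obtains p where "p \<noteq> 0" "\<And>h. S (T (polyop T p h)) = polyop T p h"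
proof -
  have D: "bounded_clinear (\<lambda>h. h - S (T h))"
    by (rule bounded_clinear_diff_map[OF bounded_clinear_id bounded_clinear_compose[OF S T]])
  have "finite_rank (\<lambda>h. h - S (T h))"
    using finite by (simp add: finite_isometry_def)
  moreover have "T x - S (T (T x)) = 0" if "x - S (T x) = 0" for x
    using that S_T_invariant[of x] by simp
  ultimately obtain p where "p \<noteq> 0" "\<And>h. polyop T p h - S (T (polyop T p h)) = 0"
    using polyop_annihilates[OF T D] by blast
  then show ?thesis
    by (intro that[of p]) auto
qed

end

theorem theorem4p1:
  fixes T :: "'a::complex_hilbert_space \<Rightarrow> 'a"
  assumes "separable_space (euclidean :: 'a topology)"
    and "bounded_clinear T"
    and "pure_hyponormal T"
    and "finite_isometry T"
  shows "\<exists>(E :: 'a set) (F :: (complex \<Rightarrow> 'a) set) ip U.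
    rkhs E F ip \<and> mult_z_analytic_shift F ip \<and>
    unitary_onto U F ip \<and> (\<forall>h. U (T h) = mult_z (U h))"
proof -
  interpret pure_finite_isometry T
    using assms(2-4) by unfold_locales
  obtain R where R: "bounded_clinear R" "\<And>h. R (T h) = h"
    using bounded_left_inverse by blast
  obtain p where p: "p \<noteq> 0" "\<And>h. S (T (polyop T p h)) = polyop T p h"
    using polynomial_into_isometric_part by blast
  note poly = bounded_clinear_polyop[OF T, of p]
  obtain C where C: "\<And>h. norm (polyop T p h) \<le> C * norm h"
    using bounded_clinear_bound[OF poly] by blast
  \<comment> \<open>Composing with \<open>p(T)\<close> moves every vector to where \<open>T\<close>
    is isometric and its coefficients shift.\<close>
  define U where "U h = (\<lambda>z. if z \<in> unit_disc
    then powser (wandering_coeff (polyop T p h)) z else 0)" for h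
  have coeff_add: "wandering_coeff (x + y) = (\<lambda>n. wandering_coeff x n + wandering_coeff y n)"
    and coeff_scale: "wandering_coeff (c *\<^sub>C x) = (\<lambda>n. c *\<^sub>C wandering_coeff x n)" for x y c
    by (auto simp: fun_eq_iff bounded_clinear_simps[OF bounded_clinear_wandering_coeff])
  note bound = norm_wandering_coeff_le
  show ?thesis
  proof (rule analytic_shift_model[of T R U])
    show "contraction T"
      using assms(4) by (simp add: finite_isometry_def)
    show "U (x + y) = U x + U y" for x y
      by (auto simp: U_def fun_eq_iff bounded_clinear_simps[OF poly]
          powser_add[OF bound bound] coeff_add)
    show "U (c *\<^sub>C x) = c *\<^sub>C U x" for c x
      by (auto simp: U_def fun_eq_iff scaleC_fun_def bounded_clinear_simps[OF poly]
          powser_scaleC[OF bound] coeff_scale)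
    show "analytic_on_disc (U h)" for h
      unfolding U_def by (rule powser_analytic[OF bound])
    show "\<exists>K. \<forall>h. norm (U h w) \<le> K * norm h" if "w \<in> unit_disc" for w
    proof -
      have w: "cmod w < 1" using that by simp
      have "norm (U h w) \<le> 2 * C / (1 - cmod w) * norm h" for h
      proof -
        have "norm (U h w) \<le> 2 * norm (polyop T p h) / (1 - cmod w)"
          using norm_powser_le[OF bound w] w by (simp add: U_def)
        also have "\<dots> \<le> 2 * (C * norm h) / (1 - cmod w)"
          using C w by (intro divide_right_mono mult_left_mono) auto
        finally show ?thesis by (simp add: mult_ac)
      qed
      then show ?thesis by blast
    qed
    \<comment> \<open>\<open>p(T)\<close> commutes with \<open>T\<close>. The series of
      \<open>T (p(T) h)\<close> starts with 0 and continues with the coefficients of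
      \<open>p(T) h\<close>, which is multiplication by \<open>z\<close>.\<close>
    show "U (T h) = mult_z (U h)" for h
    proof
      fix z
      show "U (T h) z = mult_z (U h) z"
      proof (cases "z \<in> unit_disc")
        case True
        then have z: "cmod z < 1" by simp
        show ?thesis
          using True powser_Suc[OF bound z, of "T (polyop T p h)"] p(2)[of h]
          by (simp add: U_def mult_z_def polyop_commute[OF T] wandering_coeff_T_0
              wandering_coeff_T_Suc)
      qed (simp add: U_def mult_z_def)
    qed
    \<comment> \<open>Purity enters twice: the absence of a unitary part gives
      \<open>p(T) h = 0\<close>, and the absence of eigenvectors then gives
      \<open>h = 0\<close>.\<close>
    show "h = 0" if "U h = 0" for h
    proof -
      have "powser (wandering_coeff (polyop T p h)) z = 0" if "cmod z < 1" for z
        using fun_cong[OF \<open>U h = 0\<close>, of z] that by (simp add: U_def)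
      then have "wandering_coeff (polyop T p h) n = 0" for n
        by (rule powser_eq_0D[OF bound])
      then have "polyop T p h = 0"
        using wandering_coeff_eq_0D p(2) by blast
      then show ?thesis
        using polyop_eq_0D[OF T _ p(1)] no_eigenvectors by blast
    qed
  qed (use R in \<open>auto simp: U_def\<close>)
qed

end
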